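(* Let $\mathcal{V}$ be a variety and let $T$ be a numerical semigroup. Then $\mathcal{V}_T=\{S\cap T\mid S\in\mathcal{V}\}$ is an $R$-variety. Moreover, every $R$-variety is of this form; that is, for every $R$-variety $\mathcal{R}$ there exist a variety $\mathcal{V}$ and a numerical semigroup $T$ such that $\mathcal{R}=\mathcal{V}_T$.
   Context: Let $\mathbb{N}$ be the set of nonnegative integers. A numerical semigroup is a subset $S\subseteq\mathbb{N}$ that is closed under addition, contains $0$, and has $\mathbb{N}\setminus S$ finite. For a numerical semigroup $S\neq\mathbb{N}$, $\mathrm{F}(S)=\max(\mathbb{N}\setminus S)$ is its Frobenius number. If $S\subsetneq T$ are numerical semigroups, $\mathrm{F}_T(S)=\max(T\setminus S)$. A variety is a non-empty family $\mathcal{V}$ of numerical semigroups such that: (1) if $S,T\in\mathcal{V}$ then $S\cap T\in\mathcal{V}$; (2) if $S\in\mathcal{V}$ and $S\neq\mathbb{N}$ then $S\cup\{\mathrm{F}(S)\}\in\mathcal{V}$. An $R$-variety is a non-empty family $\mathcal{R}$ of numerical semigroups such that: (1) $\mathcal{R}$ has a maximum element with respect to inclusion, denoted $\Delta(\mathcal{R})$; (2) if $S,T\in\mathcal{R}$ then $S\cap T\in\mathcal{R}$; (3) if $S\in\mathcal{R}$ and $S\neq\Delta(\mathcal{R})$ then $S\cup\{\mathrm{F}_{\Delta(\mathcal{R})}(S)\}\in\mathcal{R}$. *)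

theory Defs
  imports Main
begin

definition numerical_semigroup :: "nat set \<Rightarrow> bool" where
  "numerical_semigroup S \<longleftrightarrow>
     0 \<in> S \<and> (\<forall>x\<in>S. \<forall>y\<in>S. x + y \<in> S) \<and> finite (UNIV - S)"

text \<open>Only meaningful for a numerical semigroup \<open>S \<noteq> UNIV\<close>: the maximum of the empty set is unspecified.\<close>
definition frobenius :: "nat set \<Rightarrow> nat" where
  "frobenius S = Max (UNIV - S)"

text \<open>Only meaningful for numerical semigroups \<open>S \<subset> T\<close>.\<close>
definition rel_frobenius :: "nat set \<Rightarrow> nat set \<Rightarrow> nat" where
  "rel_frobenius T S = Max (T - S)"

definition variety :: "nat set set \<Rightarrow> bool" where
  "variety V \<longleftrightarrow>
     V \<noteq> {} \<and>
     (\<forall>S\<in>V. numerical_semigroup S) \<and>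
     (\<forall>S\<in>V. \<forall>T\<in>V. S \<inter> T \<in> V) \<and>
     (\<forall>S\<in>V. S \<noteq> UNIV \<longrightarrow> S \<union> {frobenius S} \<in> V)"

text \<open>The maximum element with respect to inclusion; only meaningful if such an element exists.\<close>
definition max_elem :: "nat set set \<Rightarrow> nat set" where
  "max_elem R = (GREATEST D. D \<in> R)"

definition R_variety :: "nat set set \<Rightarrow> bool" where
  "R_variety R \<longleftrightarrow>
     R \<noteq> {} \<and>
     (\<forall>S\<in>R. numerical_semigroup S) \<and>
     (\<exists>D\<in>R. \<forall>S\<in>R. S \<subseteq> D) \<and>
     (\<forall>S\<in>R. \<forall>T\<in>R. S \<inter> T \<in> R) \<and>
     (\<forall>S\<in>R. S \<noteq> max_elem R \<longrightarrow> S \<union> {rel_frobenius (max_elem R) S} \<in> R)"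

definition trace_family :: "nat set set \<Rightarrow> nat set \<Rightarrow> nat set set" where
  "trace_family V T = {S \<inter> T | S. S \<in> V}"

end

theory Submission
  imports Defs
begin

text \<open>
  A variety contains, together with \<open>S\<close>, every set \<open>S \<union> {n..}\<close>: adjoining Frobenius numbers one
  after another fills the gaps of \<open>S\<close> from above (\<open>variety_fill_above\<close>). For \<open>n = 0\<close> this puts
  \<open>UNIV\<close> into the variety, so that \<open>T\<close> itself is the maximum of the traces \<open>S \<inter> T\<close>. For
  \<open>n = Max (T - S)\<close> it supplies the remaining axiom of an \<open>R\<close>-variety, because \<open>S \<union> {n..}\<close> meets
  \<open>T\<close> exactly in \<open>S \<inter> T\<close> with \<open>n\<close> adjoined.

  Conversely, given an \<open>R\<close>-variety \<open>R\<close> with maximum \<open>T\<close>, the family of all numerical semigroups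
  whose trace on \<open>T\<close> lies in \<open>R\<close> is a variety: adjoining the Frobenius number of \<open>S\<close> either leaves
  the trace unchanged or, when that number lies in \<open>T\<close>, adjoins to the trace its relative Frobenius
  number. The traces of this family are exactly the members of \<open>R\<close>, because each member of \<open>R\<close> is
  a numerical semigroup and is its own trace.
\<close>

lemma numerical_semigroup_Int:
  assumes "numerical_semigroup S" "numerical_semigroup T"
  shows "numerical_semigroup (S \<inter> T)"
  using assms by (auto simp: numerical_semigroup_def Diff_Int)

lemma frobenius_not_mem:
  assumes "numerical_semigroup S" "S \<noteq> UNIV"
  shows "frobenius S \<notin> S"
proof -
  have "Max (UNIV - S) \<in> UNIV - S"
    using assms by (intro Max_in) (auto simp: numerical_semigroup_def)
  then show ?thesis by (simp add: frobenius_def)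
qed

lemma mem_if_above_frobenius:
  assumes "numerical_semigroup S" "frobenius S < x"
  shows "x \<in> S"
proof (rule ccontr)
  assume "x \<notin> S"
  then have "x \<le> frobenius S"
    using assms(1) by (auto simp: frobenius_def numerical_semigroup_def)
  then show False using assms(2) by simp
qed

text \<open>The sum of the Frobenius number and a positive number exceeds the Frobenius number, so it
  lies in \<open>S\<close> already.\<close>

lemma numerical_semigroup_insert_frobenius:
  assumes S: "numerical_semigroup S" "S \<noteq> UNIV"
  shows "numerical_semigroup (S \<union> {frobenius S})"
proof -
  let ?f = "frobenius S"
  have f_plus: "?f + x \<in> S \<union> {?f}" for x
    by (cases "x = 0") (auto intro: mem_if_above_frobenius[OF S(1)])
  have "x + y \<in> S \<union> {?f}" if "x \<in> S \<union> {?f}" "y \<in> S \<union> {?f}" for x y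
    using that f_plus[of x] f_plus[of y] S(1)
    by (auto simp: numerical_semigroup_def add.commute)
  moreover have "finite (UNIV - (S \<union> {?f}))"
    using S(1) by (auto simp: numerical_semigroup_def intro: rev_finite_subset)
  ultimately show ?thesis
    using S(1) by (simp add: numerical_semigroup_def)
qed

text \<open>Downward induction on \<open>n\<close>, starting at a bound beyond which \<open>S\<close> has no gaps: if \<open>n\<close> is a
  gap of \<open>S\<close>, then it is the Frobenius number of \<open>S \<union> {Suc n..}\<close>.\<close>

lemma variety_fill_above:
  assumes V: "variety V" and S: "S \<in> V"
  shows "S \<union> {n..} \<in> V"
proof -
  have "finite (UNIV - S)"
    using V S by (auto simp: variety_def numerical_semigroup_def)
  then obtain N where N: "\<And>x. x \<notin> S \<Longrightarrow> x < N"
    by (metis DiffI UNIV_I finite_nat_set_iff_bounded)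
  have no_gaps: "S \<union> {m..} = S" if "N \<le> m" for m
    using N that by fastforce
  show ?thesis
  proof (cases "n \<le> N")
    case True
    then show ?thesis
    proof (induction rule: inc_induct)
      case base
      then show ?case using no_gaps[of N] S by simp
    next
      case (step n)
      show ?case
      proof (cases "n \<in> S")
        case True
        then have "S \<union> {n..} = S \<union> {Suc n..}"
          by (auto simp: Suc_le_eq le_less)
        then show ?thesis using step by simp
      next
        case False
        have frob: "frobenius (S \<union> {Suc n..}) = n"
          unfolding frobenius_def
          by (rule Max_eqI) (use False in \<open>auto intro: finite_subset[of _ "{..n}"]\<close>)
        have "S \<union> {Suc n..} \<noteq> UNIV"
          using False by auto
        then have "(S \<union> {Suc n..}) \<union> {n} \<in> V"
          using V step frob unfolding variety_def by metis
        moreover have "(S \<union> {Suc n..}) \<union> {n} = S \<union> {n..}"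
          by (auto simp: Suc_le_eq le_less)
        ultimately show ?thesis by simp
      qed
    qed
  next
    case False
    then show ?thesis using no_gaps[of n] S by simp
  qed
qed

lemma max_elem_eqI:
  assumes "D \<in> R" "\<And>S. S \<in> R \<Longrightarrow> S \<subseteq> D"
  shows "max_elem R = D"
  unfolding max_elem_def using assms by (intro Greatest_equality) auto

lemma R_variety_trace_family:
  assumes V: "variety V" and T: "numerical_semigroup T"
  shows "R_variety (trace_family V T)"
proof -
  obtain S0 where "S0 \<in> V" using V by (auto simp: variety_def)
  from variety_fill_above[OF V this, of 0] have "UNIV \<in> V" by (simp add: atLeast_0)
  then have T_mem: "T \<in> trace_family V T" by (auto simp: trace_family_def)
  have T_max: "S \<subseteq> T" if "S \<in> trace_family V T" for S
    using that by (auto simp: trace_family_def)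
  have max: "max_elem (trace_family V T) = T"
    using T_mem T_max by (rule max_elem_eqI)
  have numerical: "numerical_semigroup S" if "S \<in> trace_family V T" for S
    using that V T by (auto simp: trace_family_def variety_def intro: numerical_semigroup_Int)
  have inter: "A \<inter> B \<in> trace_family V T"
    if AB_mem: "A \<in> trace_family V T" "B \<in> trace_family V T" for A B
  proof -
    obtain S S' where "S \<in> V" "S' \<in> V" and AB: "A = S \<inter> T" "B = S' \<inter> T"
      using AB_mem unfolding trace_family_def by blast
    then have "S \<inter> S' \<in> V" using V by (auto simp: variety_def)
    moreover have "A \<inter> B = (S \<inter> S') \<inter> T" using AB by auto
    ultimately show ?thesis by (auto simp: trace_family_def)
  qed
  have extend: "A \<union> {rel_frobenius T A} \<in> trace_family V T"
    if A: "A \<in> trace_family V T" "A \<noteq> T" for A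
  proof -
    obtain S where S: "S \<in> V" "A = S \<inter> T"
      using A by (auto simp: trace_family_def)
    define f where "f = rel_frobenius T A"
    have fin: "finite (T - A)"
      using numerical[OF A(1)] by (auto simp: numerical_semigroup_def intro: rev_finite_subset)
    have "f \<in> T"
      using Max_in[OF fin] T_max[OF A(1)] A(2) by (auto simp: f_def rel_frobenius_def)
    moreover have "x \<in> A" if "x \<in> T" "f < x" for x
      using that Max_ge[OF fin, of x] by (force simp: f_def rel_frobenius_def)
    ultimately have "A \<union> {f} = (S \<union> {f..}) \<inter> T"
      using S(2) by (auto simp: le_less)
    then show ?thesis
      using variety_fill_above[OF V S(1)] by (auto simp: trace_family_def f_def)
  qed
  show ?thesis
    unfolding R_variety_def max
    using T_mem T_max numerical inter extend by blast
qed

lemma R_variety_is_trace_family: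
  assumes R: "R_variety R"
  shows "\<exists>V T. variety V \<and> numerical_semigroup T \<and> R = trace_family V T"
proof -
  obtain T where T: "T \<in> R" "\<And>S. S \<in> R \<Longrightarrow> S \<subseteq> T"
    using R by (auto simp: R_variety_def)
  have max: "max_elem R = T" using T by (rule max_elem_eqI)
  have numerical: "numerical_semigroup S" if "S \<in> R" for S
    using R that by (simp add: R_variety_def)
  have inter: "A \<inter> B \<in> R" if "A \<in> R" "B \<in> R" for A B
    using R that by (simp add: R_variety_def)
  have extend: "A \<union> {rel_frobenius T A} \<in> R" if "A \<in> R" "A \<noteq> T" for A
    using R that unfolding R_variety_def max by blast
  define V where "V = {S. numerical_semigroup S \<and> S \<inter> T \<in> R}"
  have "T \<in> V" using T(1) numerical by (simp add: V_def)
  moreover have "A \<inter> B \<in> V" if "A \<in> V" "B \<in> V" for A B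
  proof -
    have "(A \<inter> B) \<inter> T = (A \<inter> T) \<inter> (B \<inter> T)" by auto
    then show ?thesis
      using that inter[of "A \<inter> T" "B \<inter> T"] by (auto simp: V_def intro: numerical_semigroup_Int)
  qed
  moreover have "S \<union> {frobenius S} \<in> V" if S: "S \<in> V" "S \<noteq> UNIV" for S
  proof -
    let ?f = "frobenius S"
    have num: "numerical_semigroup S" and trace: "S \<inter> T \<in> R"
      using S(1) by (auto simp: V_def)
    have "(S \<union> {?f}) \<inter> T \<in> R"
    proof (cases "?f \<in> T")
      case True
      note not_mem = frobenius_not_mem[OF num S(2)]
      have "finite (T - S \<inter> T)"
        using num by (auto simp: numerical_semigroup_def intro: rev_finite_subset)
      then have "rel_frobenius T (S \<inter> T) = ?f"
        unfolding rel_frobenius_def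
        using True not_mem mem_if_above_frobenius[OF num]
        by (intro Max_eqI) (auto simp: not_less[symmetric])
      moreover have "S \<inter> T \<noteq> T" using True not_mem by auto
      ultimately have "S \<inter> T \<union> {?f} \<in> R" using extend[OF trace] by simp
      moreover have "(S \<union> {?f}) \<inter> T = S \<inter> T \<union> {?f}" using True by auto
      ultimately show ?thesis by simp
    next
      case False
      then have "(S \<union> {?f}) \<inter> T = S \<inter> T" by auto
      then show ?thesis using trace by simp
    qed
    then show ?thesis
      using numerical_semigroup_insert_frobenius[OF num S(2)] by (simp add: V_def)
  qed
  ultimately have "variety V"
    unfolding variety_def by (auto simp: V_def)
  moreover have "R = trace_family V T"
  proof
    show "R \<subseteq> trace_family V T"
    proof
      fix S assume S: "S \<in> R"
      then have "S \<inter> T = S" using T(2) by auto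
      then show "S \<in> trace_family V T"
        using S numerical by (force simp: trace_family_def V_def)
    qed
    show "trace_family V T \<subseteq> R" by (auto simp: trace_family_def V_def)
  qed
  ultimately show ?thesis using numerical[OF T(1)] by blast
qed

theorem theorem2p9:
  shows "(\<forall>V T. variety V \<and> numerical_semigroup T \<longrightarrow> R_variety (trace_family V T)) \<and>
         (\<forall>R. R_variety R \<longrightarrow>
            (\<exists>V T. variety V \<and> numerical_semigroup T \<and> R = trace_family V T))"
  using R_variety_trace_family R_variety_is_trace_family by blast

end
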